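(* Let $N,K,n$ be integers with $0<K<N$ and $0<n<N$, let $\mu=nK/N$, and let $t_c$ be the vertex (unique critical point) of the quadratic polynomial $$A_1(t)=\frac12\Bigl[(W_1-1)\,B_2-\bigl(a^{-1}+d^{-1}\bigr)B_2(t+1)-\bigl(b^{-1}+c^{-1}\bigr)B_2(1-t)\Bigr]$$ in $t$. Then $$t_c=-\frac{(N-2n)(N-2K)}{2N^{2}},\qquad \mu+t_c+\tfrac12-\frac{(n+1)(K+1)}{N+2}=-\frac{(2K-N)(2n-N)}{N^{2}\,(N+2)},$$ and the discrepancy satisfies $$\Bigl|\mu+t_c+\tfrac12-\frac{(n+1)(K+1)}{N+2}\Bigr|<\frac1{N+2}.$$ Consequently: (i) whenever $(n+1)(K+1)/(N+2)\notin\mathbb{Z}$, the unit window $\bigl(\mu+t_c-\tfrac12,\,\mu+t_c+\tfrac12\bigr]$ contains exactly one integer, and it is the mode $k^{*}=\bigl\lfloor\frac{(n+1)(K+1)}{N+2}\bigr\rfloor$ of $\mathrm{Hyp}(N,K,n)$; (ii) when $x:=(n+1)(K+1)/(N+2)\in\mathbb{Z}$, in which case the law has the two tied modes $x-1$ and $x$, the boundary of the window falls within $1/(N+2)$ of the tied pair (its lower and upper endpoints lie within $1/(N+2)$ of $x-1$ and $x$ respectively), and the integer contained in the window is one of the two modes.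
   Context: The hypergeometric law $\mathrm{Hyp}(N,K,n)$ has mass function $P(k)=\binom Kk\binom{N-K}{n-k}\big/\binom Nn$, with mean $\mu=nK/N$. A mode is an integer at which $P$ attains its maximum. Notation: $\kappa=K/N$, $\eta=n/N$, $$a=\kappa\eta,\quad b=\kappa(1-\eta),\quad c=\eta(1-\kappa),\quad d=(1-\kappa)(1-\eta),$$ $W_1=\kappa^{-1}+(1-\kappa)^{-1}+\eta^{-1}+(1-\eta)^{-1}$, $B_2(t)=t^{2}-t+\tfrac16$ and $B_2=B_2(0)=\tfrac16$. The polynomial $A_1(t)$ is the coefficient of $N^{-1}$ in the asymptotic expansion of $\log[\sqrt{2\pi N ad}\,P(\mu+t)]$ as $N\to\infty$ with $t$ bounded and $(\kappa,\eta)$ in a compact subset of $(0,1)^2$. *)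

theory Defs
  imports "HOL-Probability.Probability"
begin

text \<open>The mass function of \<open>Hyp(N,K,n)\<close>, extended by zero to all integers. For
  \<open>0 \<le> k \<le> n\<close> the binomial coefficients already vanish outside the support.\<close>

definition hyp_mass :: "nat \<Rightarrow> nat \<Rightarrow> nat \<Rightarrow> int \<Rightarrow> real" where
  "hyp_mass N K n k =
     (if 0 \<le> k \<and> k \<le> int n
      then real (K choose nat k) * real ((N - K) choose (n - nat k)) / real (N choose n)
      else 0)"

definition Hyp :: "nat \<Rightarrow> nat \<Rightarrow> nat \<Rightarrow> int pmf" where
  "Hyp N K n = embed_pmf (hyp_mass N K n)"

lemma hyp_mass_nonneg: "0 \<le> hyp_mass N K n k"
  by (simp add: hyp_mass_def)

lemma sum_hyp_mass:
  assumes "K \<le> N" "n \<le> N"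
  shows "(\<Sum>k\<in>{0..int n}. hyp_mass N K n k) = 1"
proof -
  have im: "{0..int n} = int ` {..n}"
    using image_int_atLeastAtMost[of 0 n] by (simp add: atLeast0AtMost)
  have "(\<Sum>k\<in>{0..int n}. hyp_mass N K n k) = (\<Sum>k\<le>n. hyp_mass N K n (int k))"
    unfolding im by (subst sum.reindex) auto
  also have "\<dots> = (\<Sum>k\<le>n. real ((K choose k) * ((N - K) choose (n - k)))) / real (N choose n)"
    by (simp add: hyp_mass_def sum_divide_distrib)
  also have "\<dots> = real (\<Sum>k\<le>n. (K choose k) * ((N - K) choose (n - k))) / real (N choose n)"
    by simp
  also have "\<dots> = real ((K + (N - K)) choose n) / real (N choose n)"
    by (simp only: vandermonde)
  also have "\<dots> = 1"
    using assms by simp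
  finally show ?thesis .
qed

text \<open>\<open>embed_pmf\<close> is meaningful only for a probability mass function; this is the case here.\<close>

lemma pmf_Hyp:
  assumes "K \<le> N" "n \<le> N"
  shows "pmf (Hyp N K n) k = hyp_mass N K n k"
  unfolding Hyp_def
proof (rule pmf_embed_pmf)
  show "0 \<le> hyp_mass N K n x" for x
    by (rule hyp_mass_nonneg)
  have "(\<integral>\<^sup>+ x. ennreal (hyp_mass N K n x) \<partial>count_space UNIV)
      = (\<integral>\<^sup>+ x. ennreal (hyp_mass N K n x) \<partial>count_space {0..int n})"
    by (rule nn_integral_count_space_eq) (auto simp: hyp_mass_def)
  also have "\<dots> = (\<Sum>x\<in>{0..int n}. ennreal (hyp_mass N K n x))"
    by (rule nn_integral_count_space_finite) simp
  also have "\<dots> = ennreal (\<Sum>x\<in>{0..int n}. hyp_mass N K n x)"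
    by (rule sum_ennreal) (rule hyp_mass_nonneg)
  also have "\<dots> = 1"
    by (simp add: sum_hyp_mass[OF assms])
  finally show "(\<integral>\<^sup>+ x. ennreal (hyp_mass N K n x) \<partial>count_space UNIV) = 1" .
qed

definition is_mode :: "int pmf \<Rightarrow> int \<Rightarrow> bool" where
  "is_mode p k \<longleftrightarrow> (\<forall>j. pmf p j \<le> pmf p k)"

definition B2 :: "real \<Rightarrow> real" where
  "B2 t = t\<^sup>2 - t + 1 / 6"

definition W1 :: "real \<Rightarrow> real \<Rightarrow> real" where
  "W1 \<kappa> \<eta> = 1 / \<kappa> + 1 / (1 - \<kappa>) + 1 / \<eta> + 1 / (1 - \<eta>)"

text \<open>The coefficient of \<open>1 / N\<close> in the expansion of \<open>log (sqrt (2 \<pi> N a d) P(\<mu> + t))\<close>,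
  in closed form.\<close>

definition A1 :: "real \<Rightarrow> real \<Rightarrow> real \<Rightarrow> real" where
  "A1 \<kappa> \<eta> t =
     (let a = \<kappa> * \<eta>; b = \<kappa> * (1 - \<eta>); c = \<eta> * (1 - \<kappa>); d = (1 - \<kappa>) * (1 - \<eta>)
      in 1 / 2 * ((W1 \<kappa> \<eta> - 1) * B2 0
                  - (1 / a + 1 / d) * B2 (t + 1)
                  - (1 / b + 1 / c) * B2 (1 - t)))"

definition critical_point :: "(real \<Rightarrow> real) \<Rightarrow> real \<Rightarrow> bool" where
  "critical_point f t \<longleftrightarrow> (f has_real_derivative 0) (at t)"

definition window_ints :: "real \<Rightarrow> int set" where
  "window_ints m = {k. real_of_int k \<in> {m - 1 / 2 <.. m + 1 / 2}}"

end

theory Submission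
  imports Defs
begin

text \<open>
  Write \<open>\<kappa> = K / N\<close> and \<open>\<eta> = n / N\<close>. Since \<open>a d = b c = V\<close> with
  \<open>V = \<kappa> (1 - \<kappa>) \<eta> (1 - \<eta>)\<close>, and since \<open>a + b + c + d = 1\<close> and
  \<open>a + d - b - c = (1 - 2 \<kappa>) (1 - 2 \<eta>)\<close>, the four reciprocals in \<open>A\<^sub>1\<close> combine: up to a constant,
  \<open>A\<^sub>1 t\<close> is \<open>- (t\<^sup>2 + (1 - 2 \<kappa>) (1 - 2 \<eta>) t) / (2 V)\<close>. This gives the vertex \<open>t\<^sub>c\<close>, and the formula
  for the discrepancy between \<open>\<mu> + t\<^sub>c + 1/2\<close> and \<open>x = (n + 1) (K + 1) / (N + 2)\<close> is then field
  arithmetic. Its absolute value is below \<open>1 / (N + 2)\<close> because \<open>\<bar>2 K - N\<bar> < N\<close> and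
  \<open>\<bar>2 n - N\<bar> < N\<close>.

  The window \<open>(m - 1/2, m + 1/2]\<close> contains precisely the integer \<open>\<lfloor>m + 1/2\<rfloor>\<close>. Now \<open>x\<close> is a multiple
  of \<open>1 / (N + 2)\<close>, so a non-integral \<open>x\<close> has distance at least \<open>1 / (N + 2)\<close> from every integer,
  and a shift by less than that does not change the floor. If \<open>x\<close> is an integer, the shift
  changes the floor by at most one, to \<open>x - 1\<close>.

  The modes come from the ratio of consecutive masses, used in the division-free form
  \<open>k (N - K - n + k) P(k) = (K - k + 1) (n - k + 1) P(k - 1)\<close>, which holds for all integers \<open>k\<close>
  (\<open>hyp_mass_recurrence\<close>). The right coefficient minus the left one is
  \<open>(n + 1) (K + 1) - k (N + 2)\<close>, which has the sign of \<open>x - k\<close>. So on the support the mass increases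
  strictly as long as \<open>k < x\<close> and decreases strictly once \<open>k > x\<close>, and \<open>P(x - 1) = P(x)\<close> when \<open>x\<close> is
  an integer (\<open>hyp_modes\<close>).
\<close>

section \<open>The vertex of the quadratic\<close>

lemma A1_quadratic_form:
  assumes "0 < \<kappa>" "\<kappa> < 1" "0 < \<eta>" "\<eta> < 1"
  shows "A1 \<kappa> \<eta> t = (W1 \<kappa> \<eta> - 1) / 12
           - (t\<^sup>2 + (1 - 2 * \<kappa>) * (1 - 2 * \<eta>) * t + 1 / 6) / (2 * (\<kappa> * (1 - \<kappa>) * \<eta> * (1 - \<eta>)))"
proof -
  define a b c d V where "a = \<kappa> * \<eta>" and "b = \<kappa> * (1 - \<eta>)" and "c = \<eta> * (1 - \<kappa>)"
    and "d = (1 - \<kappa>) * (1 - \<eta>)" and "V = \<kappa> * (1 - \<kappa>) * \<eta> * (1 - \<eta>)"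
  have nz: "\<kappa> \<noteq> 0" "1 - \<kappa> \<noteq> 0" "\<eta> \<noteq> 0" "1 - \<eta> \<noteq> 0"
    using assms by auto
  have ad: "1 / a + 1 / d = (a + d) / V"
    unfolding a_def d_def V_def using nz by (simp add: divide_simps)
  have bc: "1 / b + 1 / c = (b + c) / V"
    unfolding b_def c_def V_def using nz by (simp add: divide_simps)
  have "(a + d) * B2 (t + 1) + (b + c) * B2 (1 - t)
      = t\<^sup>2 + (1 - 2 * \<kappa>) * (1 - 2 * \<eta>) * t + 1 / 6"
    unfolding a_def b_def c_def d_def B2_def by (simp add: algebra_simps power2_eq_square)
  then have eq: "(a + d) / V * B2 (t + 1) + (b + c) / V * B2 (1 - t)
      = (t\<^sup>2 + (1 - 2 * \<kappa>) * (1 - 2 * \<eta>) * t + 1 / 6) / V"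
    by (simp flip: add_divide_distrib)
  have "A1 \<kappa> \<eta> t = 1 / 2 * ((W1 \<kappa> \<eta> - 1) * B2 0
      - ((a + d) / V * B2 (t + 1) + (b + c) / V * B2 (1 - t)))"
    unfolding ad[symmetric] bc[symmetric] unfolding A1_def a_def b_def c_def d_def Let_def
    by (simp add: algebra_simps)
  also have "\<dots> = (W1 \<kappa> \<eta> - 1) / 12
      - (t\<^sup>2 + (1 - 2 * \<kappa>) * (1 - 2 * \<eta>) * t + 1 / 6) / (2 * V)"
    unfolding eq by (simp add: B2_def right_diff_distrib)
  finally show ?thesis
    unfolding V_def .
qed

lemma A1_eq_poly:
  assumes "0 < \<kappa>" "\<kappa> < 1" "0 < \<eta>" "\<eta> < 1"
  shows "\<exists>p :: real poly. degree p = 2 \<and> A1 \<kappa> \<eta> = poly p"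
proof -
  define V where "V = \<kappa> * (1 - \<kappa>) * \<eta> * (1 - \<eta>)"
  have V: "V \<noteq> 0"
    using assms by (simp add: V_def)
  define p where "p = [:(W1 \<kappa> \<eta> - 1) / 12 - 1 / (12 * V),
    - ((1 - 2 * \<kappa>) * (1 - 2 * \<eta>) / (2 * V)), - (1 / (2 * V)):]"
  have "degree p = 2"
    using V by (simp add: p_def)
  moreover have "A1 \<kappa> \<eta> t = poly p t" for t
    unfolding A1_quadratic_form[OF assms] V_def[symmetric] p_def using V
    by (simp add: field_simps power2_eq_square)
  ultimately show ?thesis by blast
qed

lemma critical_point_A1_iff:
  assumes "0 < \<kappa>" "\<kappa> < 1" "0 < \<eta>" "\<eta> < 1"
  shows "critical_point (A1 \<kappa> \<eta>) t \<longleftrightarrow> t = - ((1 - 2 * \<kappa>) * (1 - 2 * \<eta>) / 2)"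
proof -
  define V where "V = \<kappa> * (1 - \<kappa>) * \<eta> * (1 - \<eta>)"
  define s where "s = (1 - 2 * \<kappa>) * (1 - 2 * \<eta>)"
  have V: "V \<noteq> 0"
    using assms by (simp add: V_def)
  have "A1 \<kappa> \<eta> = (\<lambda>t. (W1 \<kappa> \<eta> - 1) / 12 - (t\<^sup>2 + s * t + 1 / 6) / (2 * V))"
    using A1_quadratic_form[OF assms] by (simp add: V_def s_def fun_eq_iff)
  then have D: "(A1 \<kappa> \<eta> has_real_derivative - ((2 * t + s) / (2 * V))) (at t)"
    using V by (auto intro!: derivative_eq_intros simp: field_simps)
  have "critical_point (A1 \<kappa> \<eta>) t \<longleftrightarrow> - ((2 * t + s) / (2 * V)) = 0"
    unfolding critical_point_def using D DERIV_unique[OF D] by metis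
  also have "\<dots> \<longleftrightarrow> t = - (s / 2)"
    using V by auto
  finally show ?thesis
    unfolding s_def .
qed

section \<open>The modes of the hypergeometric law\<close>

lemma argmax_unimodal:
  fixes f :: "int \<Rightarrow> 'a :: linorder"
  assumes up: "\<And>k. k < l \<Longrightarrow> f (k - 1) \<le> f k"
    and down: "\<And>k. m < k \<Longrightarrow> f (k + 1) \<le> f k"
    and strict: "f (l - 1) < f l" "f (m + 1) < f m"
    and plateau: "\<And>k. l \<le> k \<Longrightarrow> k \<le> m \<Longrightarrow> f k = c"
    and "l \<le> m"
  shows "{k. \<forall>j. f j \<le> f k} = {l..m}"
proof -
  have below: "f j \<le> f (l - 1)" if "j \<le> l - 1" for j
    using that
  proof (induction rule: int_le_induct)
    case (step i)
    then show ?case using up[of i] by force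
  qed simp
  have left: "f j < c" if "j < l" for j
    using that below[of j] strict(1) plateau[of l] \<open>l \<le> m\<close> by force
  have above: "f j \<le> f (m + 1)" if "m + 1 \<le> j" for j
    using that
  proof (induction rule: int_ge_induct)
    case (step i)
    then show ?case using down[of i] by force
  qed simp
  have right: "f j < c" if "m < j" for j
    using that above[of j] strict(2) plateau[of m] \<open>l \<le> m\<close> by force
  have le: "f j \<le> c" for j
    using left[of j] right[of j] plateau[of j] by (cases "j < l"; cases "m < j") auto
  show ?thesis
  proof (intro equalityI subsetI)
    fix k assume "k \<in> {k. \<forall>j. f j \<le> f k}"
    then have "c \<le> f k"
      using plateau[of l] \<open>l \<le> m\<close> by auto
    then show "k \<in> {l..m}"
      using left[of k] right[of k] by force
  next
    fix k assume "k \<in> {l..m}"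
    then show "k \<in> {k. \<forall>j. f j \<le> f k}"
      using le plateau[of k] by auto
  qed
qed

lemma binomial_step:
  "real (Suc j) * real (m choose Suc j) = (real m - real j) * real (m choose j)"
proof (cases "j \<le> m")
  case True
  have "Suc j * (m choose Suc j) = (m - j) * (m choose j)"
    by (metis binomial_absorption binomial_absorb_comp)
  then show ?thesis
    using True by (metis of_nat_diff of_nat_mult)
qed (simp add: binomial_eq_0)

text \<open>Inside \<open>1 \<le> k \<le> n\<close> this is the absorption identity for each of the two binomial coefficients.
  At \<open>k = 0\<close> the left coefficient vanishes and at \<open>k = n + 1\<close> the right one, which is where the
  mass function is cut off.\<close>

lemma hyp_mass_recurrence:
  assumes "K \<le> N"
  shows "of_int (k * (int N - int K - int n + k)) * hyp_mass N K n k
       = of_int ((int K - k + 1) * (int n - k + 1)) * hyp_mass N K n (k - 1)"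
proof -
  consider "k \<le> 0" | "k = int n + 1" | "k > int n + 1" | "1 \<le> k" "k \<le> int n"
    by linarith
  then show ?thesis
  proof cases
    case 4
    obtain j where j: "k = int (Suc j)"
      using 4(1) by (metis zero_less_imp_eq_int int_one_le_iff_zero_less gr0_implies_Suc of_nat_0_less_iff)
    then obtain i where i: "n = Suc (j + i)"
      using 4(2) by (metis less_imp_Suc_add Suc_le_lessD of_nat_le_iff)
    have ni: "n - Suc j = i" "n - j = Suc i"
      using i by auto
    have 1: "real (Suc j) * real (K choose Suc j) = (real K - real j) * real (K choose j)"
      by (rule binomial_step)
    have 2: "real (Suc i) * real ((N - K) choose Suc i)
        = (real N - real K - real i) * real ((N - K) choose i)"
      using binomial_step[of i "N - K"] assms by (simp add: of_nat_diff)
    have "real (Suc j) * (real N - real K - real i)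
            * (real (K choose Suc j) * real ((N - K) choose i))
        = (real (Suc j) * real (K choose Suc j))
            * ((real N - real K - real i) * real ((N - K) choose i))"
      by (simp only: mult_ac)
    also have "\<dots> = (real K - real j) * real (Suc i)
            * (real (K choose j) * real ((N - K) choose Suc i))"
      unfolding 1 2[symmetric] by (simp only: mult_ac)
    finally have eq: "real (Suc j) * (real N - real K - real i)
            * (real (K choose Suc j) * real ((N - K) choose i))
        = (real K - real j) * real (Suc i)
            * (real (K choose j) * real ((N - K) choose Suc i))" .
    have nat_k: "nat k = Suc j" "nat (k - 1) = j"
      using j by auto
    have m: "hyp_mass N K n k
          = real (K choose Suc j) * real ((N - K) choose i) / real (N choose n)"
        "hyp_mass N K n (k - 1)
          = real (K choose j) * real ((N - K) choose Suc i) / real (N choose n)"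
      using 4 ni unfolding hyp_mass_def nat_k by auto
    have c: "k * (int N - int K - int n + k) = int (Suc j) * (int N - int K - int i)"
        "(int K - k + 1) * (int n - k + 1) = (int K - int j) * int (Suc i)"
      using i j by auto
    show ?thesis
      unfolding m c times_divide_eq_right using eq by simp
  qed (auto simp: hyp_mass_def)
qed

lemma hyp_mass_pos_iff:
  assumes "K \<le> N" "n \<le> N"
  shows "0 < hyp_mass N K n k \<longleftrightarrow>
    0 \<le> k \<and> k \<le> int n \<and> k \<le> int K \<and> int n + int K - int N \<le> k"
proof (cases "0 \<le> k \<and> k \<le> int n")
  case True
  then obtain j where j: "k = int j" "j \<le> n"
    by (metis nonneg_int_cases of_nat_le_iff)
  then have "0 < hyp_mass N K n k \<longleftrightarrow> 0 < (K choose j) \<and> 0 < ((N - K) choose (n - j))"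
    using assms by (auto simp: hyp_mass_def zero_less_mult_iff zero_less_divide_iff)
  also have "\<dots> \<longleftrightarrow> j \<le> K \<and> n - j \<le> N - K"
    by (simp add: zero_less_binomial_iff)
  finally show ?thesis
    using j assms by auto
qed (auto simp: hyp_mass_def)

text \<open>Strict comparison of two consecutive masses needs one of them to be positive, so it matters
  that \<open>\<lfloor>x\<rfloor>\<close> lies in the support, between \<open>max 0 (n + K - N)\<close> and \<open>min n K\<close>. Only the bound by
  \<open>n + K - N\<close> is not immediate: replacing \<open>K\<close> by \<open>N - K\<close> and \<open>n\<close> by \<open>N - n\<close> turns \<open>x\<close> into
  \<open>x - (n + K - N)\<close>, and the formula for the former is visibly positive.\<close>

lemma hyp_modes:
  fixes x :: real
  assumes "K \<le> N" "n \<le> N" and x: "x = (real n + 1) * (real K + 1) / (real N + 2)"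
  shows "x \<notin> \<int> \<Longrightarrow> {k. is_mode (Hyp N K n) k} = {\<lfloor>x\<rfloor>}"
    and "x = real_of_int z \<Longrightarrow> {k. is_mode (Hyp N K n) k} = {z - 1, z}"
proof -
  let ?P = "hyp_mass N K n"
  define u v where "u k = k * (int N - int K - int n + k)"
    and "v k = (int K - k + 1) * (int n - k + 1)" for k
  have rec: "of_int (u k) * ?P k = of_int (v k) * ?P (k - 1)" for k
    using hyp_mass_recurrence[OF \<open>K \<le> N\<close>] by (simp add: u_def v_def)
  have "real_of_int (v k - u k) = (x - of_int k) * (real N + 2)" for k
    unfolding u_def v_def x by (simp add: field_simps)
  then have cmp: "u k < v k \<longleftrightarrow> of_int k < x" "v k < u k \<longleftrightarrow> x < of_int k" for k
    by (smt (verit) of_int_less_0_iff of_int_0_less_iff mult_less_0_iff zero_less_mult_iff of_nat_0_le_iff)+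
  \<comment> \<open>A point of the support is at least the lower end, so its successor makes both factors of \<open>u\<close>
    positive; being at most the upper end, it makes both factors of \<open>v\<close> positive.\<close>
  have u_pos: "0 < u k" if "0 < ?P (k - 1)" for k
    using that assms(1,2) by (auto simp: hyp_mass_pos_iff u_def)
  have v_pos: "0 < v k" if "0 < ?P k" for k
    using that assms(1,2) by (auto simp: hyp_mass_pos_iff v_def)
  have zero: "?P k = 0" if "\<not> 0 < ?P k" for k
    using that hyp_mass_nonneg[of N K n k] by linarith
  have rise: "?P (k - 1) < ?P k" if "of_int k < x" "0 < ?P (k - 1) \<or> 0 < ?P k" for k
  proof (cases "0 < ?P (k - 1)")
    case True
    have "of_int (u k) * ?P (k - 1) < of_int (v k) * ?P (k - 1)"
      using True that(1) cmp by simp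
    then show ?thesis
      using u_pos[OF True] by (simp flip: rec)
  qed (use that zero[of "k - 1"] in simp)
  have fall: "?P k < ?P (k - 1)" if "x < of_int k" "0 < ?P (k - 1) \<or> 0 < ?P k" for k
  proof (cases "0 < ?P k")
    case True
    have "of_int (v k) * ?P k < of_int (u k) * ?P k"
      using True that(1) cmp by simp
    then show ?thesis
      using v_pos[OF True] by (simp add: rec)
  qed (use that zero[of k] in simp)
  have up: "?P (k - 1) \<le> ?P k" if "of_int k < x" for k
    using rise[OF that] zero[of "k - 1"] zero[of k] by linarith
  have down: "?P (k + 1) \<le> ?P k" if "x < of_int (k + 1)" for k
    using fall[OF that] zero[of "k + 1"] zero[of k] by force
  have pos: "0 < ?P \<lfloor>x\<rfloor>"
  proof -
    have "0 \<le> x"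
      unfolding x by simp
    moreover have "x < real n + 1"
      using mult_strict_left_mono[of "real K + 1" "real N + 2" "real n + 1"] assms(1,2)
      unfolding x by (simp add: divide_less_eq)
    moreover have "x < real K + 1"
      using mult_strict_right_mono[of "real n + 1" "real N + 2" "real K + 1"] assms(1,2)
      unfolding x by (simp add: divide_less_eq mult.commute)
    moreover have "real n + real K - real N \<le> x"
    proof -
      have "x - (real n + real K - real N)
          = (real N - real n + 1) * (real N - real K + 1) / (real N + 2)"
        unfolding x by (simp add: field_simps)
      also have "\<dots> \<ge> 0"
        using assms(1,2) by simp
      finally show ?thesis by simp
    qed
    ultimately show ?thesis
      using assms(1,2) by (simp add: hyp_mass_pos_iff floor_le_iff le_floor_iff)
  qed
  have modes: "{k. is_mode (Hyp N K n) k} = {k. \<forall>j. ?P j \<le> ?P k}"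
    using assms(1,2) by (simp add: is_mode_def pmf_Hyp)
  show "{k. is_mode (Hyp N K n) k} = {\<lfloor>x\<rfloor>}" if "x \<notin> \<int>"
  proof -
    have "of_int \<lfloor>x\<rfloor> < x"
      using that by (metis Ints_of_int of_int_floor_le order.order_iff_strict)
    moreover have "x < of_int (\<lfloor>x\<rfloor> + 1)"
      by simp
    ultimately have "{k. \<forall>j. ?P j \<le> ?P k} = {\<lfloor>x\<rfloor>..\<lfloor>x\<rfloor>}"
      using pos rise[of "\<lfloor>x\<rfloor>"] fall[of "\<lfloor>x\<rfloor> + 1"]
      by (intro argmax_unimodal[where c = "?P \<lfloor>x\<rfloor>"] up down)
        (auto simp: less_floor_iff floor_less_iff)
    then show ?thesis
      by (simp add: modes)
  qed
  show "{k. is_mode (Hyp N K n) k} = {z - 1, z}" if z: "x = real_of_int z"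
  proof -
    have "0 < ?P z"
      using pos z by simp
    moreover have tie: "?P (z - 1) = ?P z"
    proof -
      have "u z = v z"
        using cmp[of z] z by linarith
      then show ?thesis
        using rec[of z] v_pos[OF \<open>0 < ?P z\<close>] by simp
    qed
    ultimately have "{k. \<forall>j. ?P j \<le> ?P k} = {z - 1..z}"
      using rise[of "z - 1"] fall[of "z + 1"] z
      by (intro argmax_unimodal[where c = "?P z"] up down)
        (auto simp: order.order_iff_strict dest: zless_imp_add1_zle)
    also have "\<dots> = {z - 1, z}"
      by auto
    finally show ?thesis
      by (simp add: modes)
  qed
qed

section \<open>The window\<close>

lemma window_ints_eq: "window_ints m = {\<lfloor>m + 1 / 2\<rfloor>}"
proof -
  have "k \<in> window_ints m \<longleftrightarrow> \<lfloor>m + 1 / 2\<rfloor> = k" for k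
    unfolding window_ints_def floor_eq_iff by auto
  then show ?thesis by auto
qed

text \<open>A fraction with denominator \<open>q\<close> that is not an integer is at least \<open>1 / q\<close> away from the
  integers on both sides.\<close>

lemma floor_perturbed_fraction:
  fixes p q :: int and x y :: real
  assumes "0 < q" "x = of_int p / of_int q" "x \<notin> \<int>" "\<bar>y - x\<bar> < 1 / of_int q"
  shows "\<lfloor>y\<rfloor> = \<lfloor>x\<rfloor>"
proof -
  define f where "f = \<lfloor>x\<rfloor>"
  have "of_int f < x" "x < of_int f + 1"
    using \<open>x \<notin> \<int>\<close> unfolding f_def
    by (metis Ints_of_int of_int_floor_le order.order_iff_strict, linarith)
  then have "real_of_int (f * q) < of_int p" "real_of_int p < of_int ((f + 1) * q)"
    using assms(1,2) by (simp_all add: field_simps)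
  then have "f * q + 1 \<le> p" "p + 1 \<le> (f + 1) * q"
    unfolding of_int_less_iff by linarith+
  then have "real_of_int (f * q + 1) \<le> of_int p" "real_of_int (p + 1) \<le> of_int ((f + 1) * q)"
    unfolding of_int_le_iff .
  then have "of_int f + 1 / of_int q \<le> x" "x + 1 / of_int q \<le> of_int f + 1"
    using assms(1,2) by (simp_all add: field_simps)
  then show ?thesis
    using assms(4) unfolding f_def[symmetric] floor_eq_iff by linarith
qed

section \<open>The vertex window and the mode\<close>

theorem theorem5p3:
  fixes N K n :: nat and \<mu> x t\<^sub>c :: real
  assumes "0 < K" "K < N" "0 < n" "n < N"
    and "\<mu> = real n * real K / real N"
    and "x = (real n + 1) * (real K + 1) / (real N + 2)"
    and "t\<^sub>c = (THE t. critical_point (A1 (real K / real N) (real n / real N)) t)"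
  shows
    "(\<exists>p :: real poly. degree p = 2 \<and> A1 (real K / real N) (real n / real N) = poly p) \<and>
     (\<exists>!t. critical_point (A1 (real K / real N) (real n / real N)) t) \<and>
     t\<^sub>c = - ((real N - 2 * real n) * (real N - 2 * real K) / (2 * (real N)\<^sup>2)) \<and>
     \<mu> + t\<^sub>c + 1 / 2 - x
       = - ((2 * real K - real N) * (2 * real n - real N) / ((real N)\<^sup>2 * (real N + 2))) \<and>
     \<bar>\<mu> + t\<^sub>c + 1 / 2 - x\<bar> < 1 / (real N + 2) \<and>
     (x \<notin> \<int> \<longrightarrow>
        window_ints (\<mu> + t\<^sub>c) = {\<lfloor>x\<rfloor>} \<and>
        {k. is_mode (Hyp N K n) k} = {\<lfloor>x\<rfloor>}) \<and>
     (\<forall>z :: int. x = real_of_int z \<longrightarrow>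
        {k. is_mode (Hyp N K n) k} = {z - 1, z} \<and>
        \<bar>(\<mu> + t\<^sub>c - 1 / 2) - (x - 1)\<bar> < 1 / (real N + 2) \<and>
        \<bar>(\<mu> + t\<^sub>c + 1 / 2) - x\<bar> < 1 / (real N + 2) \<and>
        (\<exists>k. window_ints (\<mu> + t\<^sub>c) = {k} \<and> is_mode (Hyp N K n) k))"
proof -
  define \<kappa> \<eta> where "\<kappa> = real K / real N" and "\<eta> = real n / real N"
  have \<kappa>\<eta>: "0 < \<kappa>" "\<kappa> < 1" "0 < \<eta>" "\<eta> < 1"
    using assms(1-4) by (simp_all add: \<kappa>_def \<eta>_def)
  have crit: "critical_point (A1 \<kappa> \<eta>) t
      \<longleftrightarrow> t = - ((real N - 2 * real n) * (real N - 2 * real K) / (2 * (real N)\<^sup>2))" for t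
    unfolding critical_point_A1_iff[OF \<kappa>\<eta>] using assms(1-4)
    by (simp add: \<kappa>_def \<eta>_def field_simps power2_eq_square)
  have tc: "t\<^sub>c = - ((real N - 2 * real n) * (real N - 2 * real K) / (2 * (real N)\<^sup>2))"
    unfolding assms(7) \<kappa>_def[symmetric] \<eta>_def[symmetric] crit by simp
  have disc: "\<mu> + t\<^sub>c + 1 / 2 - x
      = - ((2 * real K - real N) * (2 * real n - real N) / ((real N)\<^sup>2 * (real N + 2)))"
  proof -
    have "real N \<noteq> 0" "real N + 2 \<noteq> 0"
      using assms(1-4) by auto
    then show ?thesis
      unfolding tc assms(5,6) by (simp add: divide_simps power2_eq_square) algebra
  qed
  have bound: "\<bar>\<mu> + t\<^sub>c + 1 / 2 - x\<bar> < 1 / (real N + 2)"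
  proof -
    have "\<bar>2 * real K - real N\<bar> * \<bar>2 * real n - real N\<bar> < real N * real N"
      using assms(1-4) by (intro mult_strict_mono) auto
    then show ?thesis
      unfolding disc using assms(1-4)
      by (simp add: abs_mult divide_simps power2_eq_square)
  qed
  note modes = hyp_modes[OF less_imp_le[OF assms(2)] less_imp_le[OF assms(4)] assms(6)]
  have generic: "window_ints (\<mu> + t\<^sub>c) = {\<lfloor>x\<rfloor>}" if "x \<notin> \<int>"
    using floor_perturbed_fraction[of "int N + 2" x "(int n + 1) * (int K + 1)" "\<mu> + t\<^sub>c + 1 / 2"]
      that bound assms(6) by (simp add: window_ints_eq)
  have tied: "\<exists>k. window_ints (\<mu> + t\<^sub>c) = {k} \<and> is_mode (Hyp N K n) k" if "x = real_of_int z" for z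
  proof -
    have "1 / (real N + 2) \<le> 1"
      by simp
    then have "real_of_int (z - 1) \<le> \<mu> + t\<^sub>c + 1 / 2" "\<mu> + t\<^sub>c + 1 / 2 < real_of_int (z + 1)"
      using bound that by linarith+
    then have "\<lfloor>\<mu> + t\<^sub>c + 1 / 2\<rfloor> \<in> {z - 1, z}"
      by (auto simp: floor_eq_iff)
    then show ?thesis
      using modes(2)[OF that] by (auto simp: window_ints_eq)
  qed
  have shift: "(\<mu> + t\<^sub>c - 1 / 2) - (x - 1) = \<mu> + t\<^sub>c + 1 / 2 - x"
    by simp
  show ?thesis
    unfolding shift \<kappa>_def[symmetric] \<eta>_def[symmetric]
    using A1_eq_poly[OF \<kappa>\<eta>] crit tc disc bound generic tied modes by auto
qed

end
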